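(* Let $\alpha\in(0,1)$ and assume that $F^{\mathbb Q}(y)=1-g(S(y))$ with $g(y)=\chi_{(\alpha,1]}(y)$, i.e. the premium is calculated by $\mathrm{VaR}$ (the premium for $I\in\mathcal C$ is $(1+\theta)\mathbb E^{\mathbb Q}[I(Y)]=(1+\theta)\mathrm{VaR}_\alpha(I(Y))$). Then the optimal indemnity function for the insurer's mean-variance problem is $$I^*(t,y)=y\wedge a_t^*+(y-\mathrm{VaR}_\alpha(Y))_+,$$ where $$a_t^*=\inf\Big\{a\in[0,\mathrm{VaR}_\alpha(Y)]:\ \theta+F(a)+\gamma e^{r(T-t)}\Big(aS(a)-\alpha\mathrm{VaR}_\alpha(Y)-\int_a^{\mathrm{VaR}_\alpha(Y)}y\,dF(y)\Big)\ge 0\Big\},$$ that is, for every $t\in[0,T]$ the function $I^*(t,\cdot)$ attains $\inf_{I\in\mathcal C}H(t,I)$.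
   Context: Constants: $T>0$, $r>0$, $\gamma>0$, $\theta\ge 0$. $Y$ is a positive random variable (claim size) considered under two probability measures $\mathbb P$ (insurer) and $\mathbb Q$ (reinsurer), with finite first and second moments under both. $F$ and $F^{\mathbb Q}$ are its distribution functions under $\mathbb P$ and $\mathbb Q$; $S=1-F$; $F$ has a density. $\mathbb E$ is expectation under $\mathbb P$, $\mathbb E^{\mathbb Q}$ under $\mathbb Q$. $x_+=\max\{x,0\}$, $x\wedge y=\min\{x,y\}$, $\chi$ denotes an indicator function. $\mathrm{VaR}_\alpha(Y)=\inf\{y\in\mathbb R_+: F(y)\ge 1-\alpha\}$ (computed under $\mathbb P$). With the distortion function $g(y)=\chi_{(\alpha,1]}(y)$, $y\in[0,1]$, and $F^{\mathbb Q}(y)=1-g(S(y))$, the law of $Y$ under $\mathbb Q$ is the point mass at $\mathrm{VaR}_\alpha(Y)$. $\mathcal C:=\{f:\mathbb R_+\to\mathbb R_+ \mid f(0)=0,\ 0\le f(y)-f(x)\le y-x\ \text{for all } x\le y\}$. $H(t,I):=(1+\theta)\mathbb E^{\mathbb Q}[I(Y)]+\mathbb E[Y-I(Y)]+\dfrac{\gamma e^{r(T-t)}}{2}\mathbb E[(Y-I(Y))^2]$ for $I\in\mathcal C$. The insurer's problem: maximise $\mathbb E_{t,x}[X(T)]-\frac{\gamma}{2}\mathrm{Var}_{t,x}[X(T)]$ over reinsurance strategies $\{I(t,\cdot)\}$ with $I(t,\cdot)\in\mathcal C$, where $X$ is a Cramér–Lundberg surplus with claims $Y_i$ (intensity 1),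 interest rate $r$, and reinsurance premium rate $(1+\theta)\mathbb E^{\mathbb Q}[I(t,Y)]$. It is solved in the time-consistent (equilibrium) sense; via the extended HJB system, the optimal indemnity function means a family $I^*(t,\cdot)\in\mathcal C$ attaining $\inf_{I\in\mathcal C}H(t,I)$ for every $t\in[0,T]$. *)

theory Defs
  imports "HOL-Probability.Probability"
begin

definition distrib_fun :: "'a measure \<Rightarrow> ('a \<Rightarrow> real) \<Rightarrow> real \<Rightarrow> real" where
  "distrib_fun M Z = cdf (distr M borel Z)"

definition survival_fun :: "'a measure \<Rightarrow> ('a \<Rightarrow> real) \<Rightarrow> real \<Rightarrow> real" where
  "survival_fun M Z y = 1 - distrib_fun M Z y"

definition VaR :: "real \<Rightarrow> 'a measure \<Rightarrow> ('a \<Rightarrow> real) \<Rightarrow> real" where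
  "VaR \<alpha> M Z = Inf {y. 0 \<le> y \<and> distrib_fun M Z y \<ge> 1 - \<alpha>}"

definition VaR_distortion :: "real \<Rightarrow> real \<Rightarrow> real" where
  "VaR_distortion \<alpha> = indicat_real {\<alpha><..1}"

text \<open>Functions on the nonnegative half-line are modelled as total functions on the reals
  that are constrained on the nonnegative arguments only; they are only ever evaluated at values
  of a positive random variable.\<close>

definition indemnities :: "(real \<Rightarrow> real) set" where
  "indemnities = {f. f 0 = 0 \<and> (\<forall>y\<ge>0. f y \<ge> 0) \<and>
     (\<forall>x y. 0 \<le> x \<and> x \<le> y \<longrightarrow> 0 \<le> f y - f x \<and> f y - f x \<le> y - x)}"

definition premium :: "real \<Rightarrow> 'a measure \<Rightarrow> ('a \<Rightarrow> real) \<Rightarrow> (real \<Rightarrow> real) \<Rightarrow> real" where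
  "premium \<theta> Q Y I = (1 + \<theta>) * (LINT \<omega>|Q. I (Y \<omega>))"

definition mv_objective ::
  "real \<Rightarrow> real \<Rightarrow> real \<Rightarrow> real \<Rightarrow> 'a measure \<Rightarrow> 'a measure \<Rightarrow> ('a \<Rightarrow> real) \<Rightarrow>
   real \<Rightarrow> (real \<Rightarrow> real) \<Rightarrow> real" where
  "mv_objective T r \<gamma> \<theta> P Q Y t I =
     premium \<theta> Q Y I + (LINT \<omega>|P. Y \<omega> - I (Y \<omega>))
     + \<gamma> * exp (r * (T - t)) / 2 * (LINT \<omega>|P. (Y \<omega> - I (Y \<omega>))\<^sup>2)"

text \<open>Optimality for the mean-variance problem in the time-consistent (equilibrium) sense:
  the infimum in the extended HJB system is attained at every time.\<close>

definition optimal_indemnity ::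
  "real \<Rightarrow> real \<Rightarrow> real \<Rightarrow> real \<Rightarrow> 'a measure \<Rightarrow> 'a measure \<Rightarrow> ('a \<Rightarrow> real) \<Rightarrow>
   (real \<Rightarrow> real \<Rightarrow> real) \<Rightarrow> bool" where
  "optimal_indemnity T r \<gamma> \<theta> P Q Y J \<longleftrightarrow>
     (\<forall>t\<in>{0..T}. J t \<in> indemnities \<and>
        (\<forall>I\<in>indemnities. mv_objective T r \<gamma> \<theta> P Q Y t (J t) \<le> mv_objective T r \<gamma> \<theta> P Q Y t I))"

text \<open>The Stieltjes integral with respect to the distribution function of Y is the integral
  with respect to the law of Y under P.\<close>

definition VaR_retention ::
  "real \<Rightarrow> real \<Rightarrow> real \<Rightarrow> real \<Rightarrow> real \<Rightarrow> 'a measure \<Rightarrow> ('a \<Rightarrow> real) \<Rightarrow> real \<Rightarrow> real" where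
  "VaR_retention T r \<gamma> \<theta> \<alpha> P Y t =
     Inf {a \<in> {0..VaR \<alpha> P Y}.
       \<theta> + distrib_fun P Y a + \<gamma> * exp (r * (T - t)) *
         (a * survival_fun P Y a - \<alpha> * VaR \<alpha> P Y
          - (LINT y:{a<..VaR \<alpha> P Y}|distr P borel Y. y)) \<ge> 0}"

end

theory Submission
  imports Defs
begin

text \<open>
  Write \<open>v\<close> for the value at risk of \<open>Y\<close> under \<open>P\<close>. The distorted distribution function under \<open>Q\<close>
  is the step function that jumps from 0 to 1 at \<open>v\<close>, so \<open>Y = v\<close> holds \<open>Q\<close>-almost surely and an
  indemnity \<open>I\<close> is charged only for its value at the single point \<open>v\<close>. That this premium is again
  a value at risk holds because the quantile commutes with nondecreasing continuous functions
  (\<open>VaR_indemnity\<close>).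

  Fix the value \<open>a = I v\<close>, and with it the premium. The retained risk \<open>y - I y\<close> is nondecreasing
  and grows at most at unit rate, so it is bounded below, pointwise, by the layer
  \<open>max (min y v - a) 0\<close>, and the indemnity \<open>min y a + max (y - v) 0\<close> leaves exactly this layer
  with the insurer. The objective increases with the retained risk, so an indemnity of this form
  is at least as good as \<open>I\<close> (\<open>mv_objective_layer_le\<close>), and the problem reduces to
  the choice of the number \<open>a\<close> between 0 and \<open>v\<close>.

  The cost of a layer is a convex function of \<open>a\<close>, and the expression whose sign defines the
  retention is a subgradient of it (\<open>layer_cost_subgradient\<close>, rewritten by
  \<open>expectation_layer\<close>). At \<open>a = v\<close> the subgradient is \<open>\<theta> + 1 - \<alpha>\<close>, which is positive;
  hence the infimum of the points where the subgradient is nonnegative is a minimiser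
  (\<open>Inf_nonneg_subgradient_minimises\<close>). The subgradient inequality is obtained pointwise in the
  claim size and then integrated.
\<close>

section \<open>Convex functions on an interval\<close>

text \<open>The slope \<open>\<phi>\<close> is negative to the left of \<open>m\<close> and nonnegative at points of the set arbitrarily
  close to \<open>m\<close> on the right. Hence \<open>h b\<close> is at least the value of \<open>h\<close> at some point \<open>a\<close> near \<open>m\<close>
  on the same side as \<open>b\<close>. The subgradient inequality at \<open>m\<close> itself shows that \<open>h a\<close> cannot be
  much smaller than \<open>h m\<close>.\<close>

lemma Inf_nonneg_subgradient_minimises:
  fixes h \<phi> :: "real \<Rightarrow> real"
  assumes subgradient: "\<And>a b. a \<in> {0..v} \<Longrightarrow> b \<in> {0..v} \<Longrightarrow> h a + \<phi> a * (b - a) \<le> h b"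
    and "0 \<le> v" and "0 \<le> \<phi> v"
  defines "m \<equiv> Inf {a \<in> {0..v}. 0 \<le> \<phi> a}"
  shows "m \<in> {0..v}" and "b \<in> {0..v} \<Longrightarrow> h m \<le> h b"
proof -
  let ?A = "{a \<in> {0..v}. 0 \<le> \<phi> a}"
  have v: "v \<in> ?A" and bdd: "bdd_below ?A"
    using assms(2,3) by (auto intro: bdd_belowI[of _ 0])
  have m_le: "m \<le> a" if "a \<in> ?A" for a
    unfolding m_def using that bdd by (rule cInf_lower)
  have "0 \<le> m"
    unfolding m_def using v by (intro cInf_greatest) auto
  then show m: "m \<in> {0..v}"
    using m_le[OF v] by simp
  show "h m \<le> h b" if b: "b \<in> {0..v}"
  proof (rule field_le_epsilon)
    fix e :: real
    assume "0 < e"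
    define d where "d = e / (\<bar>\<phi> m\<bar> + 1)"
    have "0 < d" and d: "\<bar>\<phi> m\<bar> * d \<le> e"
      using \<open>0 < e\<close> by (auto simp: d_def field_simps)
    \<comment> \<open>It suffices to find a point \<open>a\<close> near \<open>m\<close> where the subgradient does not point downhill towards \<open>b\<close>.\<close>
    have near: "h m \<le> h b + e" if a: "a \<in> {0..v}" "\<bar>a - m\<bar> \<le> d" "0 \<le> \<phi> a * (b - a)" for a
    proof -
      have "h m - \<bar>\<phi> m\<bar> * \<bar>a - m\<bar> \<le> h m + \<phi> m * (a - m)"
        using abs_ge_minus_self[of "\<phi> m * (a - m)"] by (simp add: abs_mult)
      also have "\<dots> \<le> h a"
        using subgradient m a by blast
      also have "\<dots> \<le> h b"
        using subgradient[OF a(1) b] a(3) by simp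
      finally have "h m \<le> h b + \<bar>\<phi> m\<bar> * \<bar>a - m\<bar>" by simp
      also have "\<dots> \<le> h b + \<bar>\<phi> m\<bar> * d"
        using a(2) by (simp add: mult_left_mono)
      finally show ?thesis using d by simp
    qed
    consider "b = m" | "m < b" | "b < m" by linarith
    then show "h m \<le> h b + e"
    proof cases
      case 1
      then show ?thesis using \<open>0 < e\<close> by simp
    next
      case 2
      then have "m < min b (m + d)" using \<open>0 < d\<close> by simp
      then obtain a where a: "a \<in> ?A" "a < min b (m + d)"
        using cInf_lessD[of ?A "min b (m + d)"] v unfolding m_def by blast
      then show ?thesis using m_le[OF a(1)] by (intro near[of a]) auto
    next
      case 3
      define a where "a = max b (m - d)"
      have a: "a < m" "b \<le> a" "a \<in> {0..v}" "\<bar>a - m\<bar> \<le> d"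
        using 3 b m \<open>0 < d\<close> by (auto simp: a_def)
      then have "\<phi> a < 0" using m_le[of a] by force
      then show ?thesis
        using a by (intro near[of a]) (auto simp: mult_nonpos_nonpos)
    qed
  qed
qed

section \<open>Indemnity functions\<close>

lemma indemnitiesD:
  assumes "I \<in> indemnities"
  shows "0 \<le> x \<Longrightarrow> x \<le> y \<Longrightarrow> I x \<le> I y"
    and "0 \<le> x \<Longrightarrow> x \<le> y \<Longrightarrow> I y - I x \<le> y - x"
    and "0 \<le> y \<Longrightarrow> 0 \<le> I y" and "0 \<le> y \<Longrightarrow> I y \<le> y"
proof -
  have zero: "I 0 = 0" and nonneg: "0 \<le> z \<Longrightarrow> 0 \<le> I z"
    and incr: "0 \<le> u \<Longrightarrow> u \<le> z \<Longrightarrow> 0 \<le> I z - I u \<and> I z - I u \<le> z - u" for u z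
    using assms unfolding indemnities_def by blast+
  show "0 \<le> x \<Longrightarrow> x \<le> y \<Longrightarrow> I x \<le> I y" and "0 \<le> x \<Longrightarrow> x \<le> y \<Longrightarrow> I y - I x \<le> y - x"
    using incr[of x y] by auto
  show "0 \<le> y \<Longrightarrow> 0 \<le> I y" and "0 \<le> y \<Longrightarrow> I y \<le> y"
    using nonneg[of y] incr[of 0 y] zero by auto
qed

lemma layer_in_indemnities:
  assumes "0 \<le> a" and "a \<le> v"
  shows "(\<lambda>y. min y a + max (y - v) 0) \<in> indemnities"
  using assms unfolding indemnities_def by (auto simp: min_def max_def)

lemma borel_measurable_indemnity:
  assumes I: "I \<in> indemnities" and [measurable]: "Y \<in> borel_measurable M"
    and pos: "\<And>\<omega>. \<omega> \<in> space M \<Longrightarrow> 0 \<le> Y \<omega>"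
  shows "(\<lambda>\<omega>. I (Y \<omega>)) \<in> borel_measurable M"
proof -
  \<comment> \<open>Nothing is known of \<open>I\<close> at negative arguments, so it is extended there by the
    constant \<open>I 0\<close>, which keeps it monotone.\<close>
  have "mono (\<lambda>x. I (max 0 x))"
    using indemnitiesD(1)[OF I] by (auto intro!: monoI)
  then have [measurable]: "(\<lambda>x. I (max 0 x)) \<in> borel_measurable borel"
    by (rule borel_measurable_mono)
  have "(\<lambda>\<omega>. I (max 0 (Y \<omega>))) \<in> borel_measurable M" by measurable
  then show ?thesis
    by (rule measurable_cong[THEN iffD1, rotated]) (simp add: pos max_absorb2)
qed

text \<open>Below \<open>v\<close> the retained part falls, going left from its value \<open>v - I v\<close> at \<open>v\<close>, at most at unit
  rate and never under 0; above \<open>v\<close> it does not fall under \<open>v - I v\<close>.\<close>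

lemma retained_layer_le:
  assumes I: "I \<in> indemnities" and "0 \<le> y" and "0 \<le> v"
  shows "max (min y v - I v) 0 \<le> y - I y"
  using indemnitiesD(1)[OF I, of y v] indemnitiesD(2)[OF I, of v y]
    indemnitiesD(4)[OF I, of y] indemnitiesD(4)[OF I, of v] assms(2,3)
  by (cases "y \<le> v") auto

lemma retained_of_layer:
  assumes "a \<le> v"
  shows "y - (min y a + max (y - v) 0) = max (min y v - a) (0::real)"
  using assms by auto

section \<open>Value at risk\<close>

lemma distrib_fun_eq:
  assumes "Z \<in> borel_measurable M"
  shows "distrib_fun M Z y = measure M {\<omega> \<in> space M. Z \<omega> \<le> y}"
  using assms unfolding distrib_fun_def cdf_def
  by (subst measure_distr) (auto intro!: arg_cong[where f = "measure M"])

text \<open>The Galois connection between a quantile and its distribution function. It rests on right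
  continuity, by which the infimum that defines the quantile is attained; the limit 1 at infinity
  makes the infimum range over a nonempty set.\<close>

lemma VaR_le_iff:
  assumes "prob_space M" and Z: "Z \<in> borel_measurable M"
    and nonneg: "\<And>\<omega>. \<omega> \<in> space M \<Longrightarrow> 0 \<le> Z \<omega>" and "0 < \<alpha>" and "\<alpha> < 1"
  shows "VaR \<alpha> M Z \<le> y \<longleftrightarrow> 1 - \<alpha> \<le> distrib_fun M Z y"
proof -
  interpret M: prob_space M by fact
  interpret D: real_distribution "distr M borel Z"
    using Z by (intro M.real_distribution_distr) simp
  let ?F = "distrib_fun M Z"
  let ?A = "{y. 0 \<le> y \<and> 1 - \<alpha> \<le> ?F y}"
  have mono: "?F x \<le> ?F y" if "x \<le> y" for x y
    using D.cdf_nondecreasing[OF that] by (simp add: distrib_fun_def)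
  have neg: "?F y = 0" if "y < 0" for y
  proof -
    have "{\<omega> \<in> space M. Z \<omega> \<le> y} = {}" using that nonneg by force
    then show ?thesis unfolding distrib_fun_eq[OF Z] by (metis measure_empty)
  qed
  have "eventually (\<lambda>y. 1 - \<alpha> < ?F y) at_top"
    using order_tendstoD(1)[OF D.cdf_lim_at_top_prob, of "1 - \<alpha>"] \<open>0 < \<alpha>\<close>
    by (simp add: distrib_fun_def)
  then have "eventually (\<lambda>y. 1 - \<alpha> < ?F y \<and> 0 \<le> y) at_top"
    using eventually_ge_at_top[of 0] by (rule eventually_conj)
  then obtain y0 where "y0 \<in> ?A"
    using eventually_happens[of _ "at_top :: real filter"] by (force simp: less_imp_le)
  then have ne: "?A \<noteq> {}" by blast
  have bdd: "bdd_below ?A" by (rule bdd_belowI[of _ 0]) simp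
  have "1 - \<alpha> \<le> ?F (Inf ?A)"
  proof (rule ccontr)
    assume below: "\<not> ?thesis"
    moreover have "(?F \<longlongrightarrow> ?F (Inf ?A)) (at_right (Inf ?A))"
      using D.cdf_is_right_cont[of "Inf ?A"] by (simp add: continuous_within distrib_fun_def)
    ultimately have "eventually (\<lambda>y. ?F y < 1 - \<alpha>) (at_right (Inf ?A))"
      by (intro order_tendstoD(2)) auto
    then obtain b where b: "Inf ?A < b" "\<And>y. Inf ?A < y \<Longrightarrow> y < b \<Longrightarrow> ?F y < 1 - \<alpha>"
      by (auto simp: eventually_at_right_field)
    obtain a where a: "a \<in> ?A" "a < b"
      using cInf_lessD[OF ne b(1)] by blast
    have "a = Inf ?A"
      using cInf_lower[OF a(1) bdd] b(2)[of a] a by fastforce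
    then show False using a below by auto
  qed
  then have "1 - \<alpha> \<le> ?F y" if "VaR \<alpha> M Z \<le> y"
    using mono[OF that] by (simp add: VaR_def)
  moreover have "VaR \<alpha> M Z \<le> y" if "1 - \<alpha> \<le> ?F y"
    unfolding VaR_def using that neg[of y] \<open>\<alpha> < 1\<close> by (intro cInf_lower[OF _ bdd]) force
  ultimately show ?thesis by blast
qed

lemma VaR_nonneg:
  assumes "prob_space M" and "Z \<in> borel_measurable M"
    and "\<And>\<omega>. \<omega> \<in> space M \<Longrightarrow> 0 \<le> Z \<omega>" and "0 < \<alpha>" and "\<alpha> < 1"
  shows "0 \<le> VaR \<alpha> M Z"
proof (rule ccontr)
  assume "\<not> ?thesis"
  then have "{\<omega> \<in> space M. Z \<omega> \<le> VaR \<alpha> M Z} = {}" using assms(3) by force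
  then have "distrib_fun M Z (VaR \<alpha> M Z) = 0"
    unfolding distrib_fun_eq[OF assms(2)] by (metis measure_empty)
  then show False using VaR_le_iff[OF assms, of "VaR \<alpha> M Z"] \<open>\<alpha> < 1\<close> by simp
qed

text \<open>For nonnegative \<open>y\<close> the event that \<open>I (Y \<omega>)\<close> is at most \<open>y\<close> has probability at least \<open>1 - \<alpha>\<close>
  exactly if \<open>I\<close> is at most \<open>y\<close> at the quantile \<open>v\<close> of \<open>Y\<close>. Monotonicity of \<open>I\<close> gives one
  direction; the other also uses continuity, as \<open>I\<close> must not jump at \<open>v\<close>.\<close>

lemma VaR_indemnity:
  assumes M: "prob_space M" and Y: "Y \<in> borel_measurable M"
    and nonneg: "\<And>\<omega>. \<omega> \<in> space M \<Longrightarrow> 0 \<le> Y \<omega>" and \<alpha>: "0 < \<alpha>" "\<alpha> < 1"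
    and I: "I \<in> indemnities"
  shows "VaR \<alpha> M (\<lambda>\<omega>. I (Y \<omega>)) = I (VaR \<alpha> M Y)"
proof -
  interpret M: prob_space M by fact
  define v where "v = VaR \<alpha> M Y"
  have v: "0 \<le> v" unfolding v_def by (rule VaR_nonneg[OF M Y nonneg \<alpha>])
  have le_iff: "v \<le> y \<longleftrightarrow> 1 - \<alpha> \<le> distrib_fun M Y y" for y
    unfolding v_def by (rule VaR_le_iff[OF M Y nonneg \<alpha>])
  have IY[measurable]: "(\<lambda>\<omega>. I (Y \<omega>)) \<in> borel_measurable M"
    by (rule borel_measurable_indemnity[OF I Y nonneg])
  note [measurable] = Y
  have "1 - \<alpha> \<le> distrib_fun M (\<lambda>\<omega>. I (Y \<omega>)) y \<longleftrightarrow> I v \<le> y" if "0 \<le> y" for y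
  proof
    assume "I v \<le> y"
    then have "I (Y \<omega>) \<le> y" if "\<omega> \<in> space M" "Y \<omega> \<le> v" for \<omega>
      using indemnitiesD(1)[OF I nonneg[OF that(1)] that(2)] by simp
    then have "distrib_fun M Y v \<le> distrib_fun M (\<lambda>\<omega>. I (Y \<omega>)) y"
      unfolding distrib_fun_eq[OF Y] distrib_fun_eq[OF IY]
      by (intro M.finite_measure_mono) auto
    then show "1 - \<alpha> \<le> distrib_fun M (\<lambda>\<omega>. I (Y \<omega>)) y"
      using le_iff[of v] by simp
  next
    assume F: "1 - \<alpha> \<le> distrib_fun M (\<lambda>\<omega>. I (Y \<omega>)) y"
    show "I v \<le> y"
    proof (rule ccontr)
      assume "\<not> ?thesis"
      \<comment> \<open>Since \<open>I\<close> grows at most at unit rate, it still exceeds \<open>y\<close> at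
        this point below \<open>v\<close>.\<close>
      define z where "z = v - (I v - y) / 2"
      have yv: "y < I v" using \<open>\<not> _\<close> by simp
      then have z: "0 \<le> z" "z < v"
        using indemnitiesD(4)[OF I v] \<open>0 \<le> y\<close> by (simp_all add: z_def)
      have "I v - I z \<le> (I v - y) / 2"
        using indemnitiesD(2)[OF I z(1), of v] z(2) by (simp add: z_def)
      then have Iz: "y < I z" using yv by (simp add: field_simps)
      have "Y \<omega> \<le> z" if "\<omega> \<in> space M" "I (Y \<omega>) \<le> y" for \<omega>
        using indemnitiesD(1)[OF I z(1), of "Y \<omega>"] that Iz by force
      then have "distrib_fun M (\<lambda>\<omega>. I (Y \<omega>)) y \<le> distrib_fun M Y z"
        unfolding distrib_fun_eq[OF Y] distrib_fun_eq[OF IY]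
        by (intro M.finite_measure_mono) auto
      then show False using F le_iff[of z] z(2) by simp
    qed
  qed
  then have "{y. 0 \<le> y \<and> distrib_fun M (\<lambda>\<omega>. I (Y \<omega>)) y \<ge> 1 - \<alpha>} = {I v..}"
    using indemnitiesD(3)[OF I v] by force
  then show ?thesis by (simp add: VaR_def[of _ _ "\<lambda>\<omega>. I (Y \<omega>)"] v_def)
qed

text \<open>With a density the law has no atoms, so the distribution function cannot jump across the
  level \<open>1 - \<alpha>\<close>.\<close>

lemma distrib_fun_VaR_of_density:
  assumes M: "prob_space M" and dens: "distributed M lborel Y f"
    and pos: "\<And>\<omega>. \<omega> \<in> space M \<Longrightarrow> 0 \<le> Y \<omega>" and \<alpha>: "0 < \<alpha>" "\<alpha> < 1"
  shows "distrib_fun M Y (VaR \<alpha> M Y) = 1 - \<alpha>"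
proof -
  interpret M: prob_space M by fact
  have Y: "Y \<in> borel_measurable M"
    using distributed_measurable[OF dens] by simp
  interpret D: real_distribution "distr M borel Y"
    using Y by (intro M.real_distribution_distr) simp
  let ?v = "VaR \<alpha> M Y"
  have le_iff: "?v \<le> y \<longleftrightarrow> 1 - \<alpha> \<le> distrib_fun M Y y" for y
    by (rule VaR_le_iff[OF M Y pos \<alpha>])
  have "distr M borel Y = density lborel f"
    using distributed_distr_eq_density[OF dens] by (simp cong: distr_cong)
  then have "emeasure (distr M borel Y) {?v} = 0"
    using distributed_borel_measurable[OF dens]
    by (auto simp: emeasure_density nn_integral_indicator_singleton)
  then have "isCont (distrib_fun M Y) ?v"
    unfolding distrib_fun_def D.isCont_cdf by (simp add: measure_def)
  then have "(distrib_fun M Y \<longlongrightarrow> distrib_fun M Y ?v) (at_left ?v)"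
    by (simp add: isCont_def filterlim_at_split)
  moreover have "eventually (\<lambda>y. distrib_fun M Y y < 1 - \<alpha>) (at_left ?v)"
    unfolding eventually_at_left_field using le_iff
    by (intro exI[of _ "?v - 1"]) (auto simp flip: not_le le_iff)
  ultimately have "distrib_fun M Y ?v \<le> 1 - \<alpha>"
    by (intro tendsto_upperbound) (auto elim: eventually_mono)
  then show ?thesis using le_iff[of ?v] by simp
qed

lemma AE_eq_of_step_distrib_fun:
  assumes M: "prob_space M" and Y: "Y \<in> borel_measurable M"
    and F: "\<And>y. distrib_fun M Y y = (if v \<le> y then 1 else 0)"
  shows "AE \<omega> in M. Y \<omega> = v"
proof -
  interpret M: prob_space M by fact
  note [measurable] = Y
  have "AE \<omega> in M. Y \<omega> \<le> v"
    using F[of v] unfolding distrib_fun_eq[OF Y] by (subst M.prob_Collect_eq_1[symmetric]) simp_all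
  moreover have "AE \<omega> in M. \<forall>n. v - 1 / real (Suc n) < Y \<omega>"
  proof (subst AE_all_countable, intro allI)
    fix n
    let ?A = "{\<omega> \<in> space M. Y \<omega> \<le> v - 1 / real (Suc n)}"
    have "measure M ?A = 0"
      using F[of "v - 1 / real (Suc n)"] Y by (simp add: distrib_fun_eq)
    then have "?A \<in> null_sets M" by (auto simp: M.emeasure_eq_measure)
    then show "AE \<omega> in M. v - 1 / real (Suc n) < Y \<omega>"
      by (rule AE_I'[of ?A]) auto
  qed
  ultimately show ?thesis
  proof eventually_elim
    case (elim \<omega>)
    show ?case
    proof (rule ccontr)
      assume "Y \<omega> \<noteq> v"
      then have "0 < v - Y \<omega>" using elim by simp
      then obtain n where "1 / real (Suc n) < v - Y \<omega>"
        by (metis nat_approx_posE)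
      then show False using elim(2)[rule_format, of n] by simp
    qed
  qed
qed

text \<open>The survival function exceeds \<open>\<alpha>\<close> exactly below the value at risk, so the distorted
  distribution function is that of a point mass.\<close>

lemma AE_eq_VaR_of_distorted_law:
  assumes P: "prob_space P" and YP: "Y \<in> borel_measurable P"
    and pos: "\<And>\<omega>. \<omega> \<in> space P \<Longrightarrow> 0 \<le> Y \<omega>" and \<alpha>: "0 < \<alpha>" "\<alpha> < 1"
    and Q: "prob_space Q" and YQ: "Y \<in> borel_measurable Q"
    and distort: "\<And>y. distrib_fun Q Y y = 1 - VaR_distortion \<alpha> (survival_fun P Y y)"
  shows "AE \<omega> in Q. Y \<omega> = VaR \<alpha> P Y"
proof (rule AE_eq_of_step_distrib_fun[OF Q YQ])
  fix y
  have "0 \<le> distrib_fun P Y y" using YP by (simp add: distrib_fun_eq)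
  then show "distrib_fun Q Y y = (if VaR \<alpha> P Y \<le> y then 1 else 0)"
    by (auto simp: distort VaR_distortion_def survival_fun_def VaR_le_iff[OF P YP pos \<alpha>]
        indicator_def)
qed

section \<open>Layers of retained risk\<close>

lemma (in prob_space) survival_fun_eq:
  assumes [measurable]: "Y \<in> borel_measurable M"
  shows "survival_fun M Y a = expectation (\<lambda>\<omega>. indicat_real {a<..} (Y \<omega>))"
proof -
  have "expectation (\<lambda>\<omega>. indicat_real {a<..} (Y \<omega>)) =
      expectation (indicat_real {\<omega> \<in> space M. \<not> Y \<omega> \<le> a})"
    by (intro Bochner_Integration.integral_cong) (auto simp: indicator_def)
  also have "\<dots> = prob {\<omega> \<in> space M. \<not> Y \<omega> \<le> a}" by simp
  also have "\<dots> = 1 - prob {\<omega> \<in> space M. Y \<omega> \<le> a}" by (rule prob_neg) simp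
  finally show ?thesis by (simp add: survival_fun_def distrib_fun_eq)
qed

text \<open>This connects the layer cost with the Stieltjes form in which the retention is defined.\<close>

lemma (in prob_space) expectation_layer:
  assumes Y[measurable]: "Y \<in> borel_measurable M" and "0 \<le> a" and "a \<le> v"
  shows "expectation (\<lambda>\<omega>. max (min (Y \<omega>) v - a) 0) =
    v * survival_fun M Y v + (LINT y:{a<..v}|distr M borel Y. y) - a * survival_fun M Y a"
proof -
  have int: "integrable M (\<lambda>\<omega>. indicat_real {c<..} (Y \<omega>))" for c
    by (rule integrable_const_bound[of _ 1]) (auto simp: indicator_def)
  have int': "integrable M (\<lambda>\<omega>. indicat_real {a<..v} (Y \<omega>) * Y \<omega>)"
    using \<open>0 \<le> a\<close> by (intro integrable_const_bound[of _ "\<bar>v\<bar>"]) (auto simp: indicator_def)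
  have "expectation (\<lambda>\<omega>. max (min (Y \<omega>) v - a) 0) = expectation (\<lambda>\<omega>.
      v * indicat_real {v<..} (Y \<omega>) + indicat_real {a<..v} (Y \<omega>) * Y \<omega>
      - a * indicat_real {a<..} (Y \<omega>))"
    using \<open>a \<le> v\<close> by (intro Bochner_Integration.integral_cong) (auto simp: indicator_def)
  also have "\<dots> = v * survival_fun M Y v + expectation (\<lambda>\<omega>. indicat_real {a<..v} (Y \<omega>) * Y \<omega>)
      - a * survival_fun M Y a"
    using int int' by (simp add: survival_fun_eq)
  finally show ?thesis
    by (simp add: set_lebesgue_integral_def integral_distr)
qed

text \<open>The layer is convex in its retention \<open>a\<close>, with slope -1 as long as \<open>a\<close> is below \<open>min y v\<close>.
  At \<open>a = v < y\<close> the indicator still gives slope -1 although the layer is already flat to the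
  right; this remains a subgradient because retentions above \<open>v\<close> do not compete.\<close>

lemma layer_subgradient:
  fixes y v a b :: real
  assumes "a \<le> v" and "b \<le> v"
  shows "max (min y v - a) 0 - indicator {a<..} y * (b - a) \<le> max (min y v - b) 0"
  using assms by (auto simp: indicator_def)

text \<open>The difference of the two sides is the square of the change of the layer plus a nonnegative
  multiple of the defect in the subgradient inequality for the layer.\<close>

lemma layer_square_subgradient:
  fixes m a b :: real
  shows "(max (m - a) 0)\<^sup>2 - 2 * max (m - a) 0 * (b - a) \<le> (max (m - b) 0)\<^sup>2"
proof -
  have "0 \<le> max (m - a) 0 * (max (m - b) 0 - max (m - a) 0 + (b - a))"
    by (cases "m \<le> a") auto
  then have "0 \<le> (max (m - b) 0 - max (m - a) 0)\<^sup>2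
      + 2 * (max (m - a) 0 * (max (m - b) 0 - max (m - a) 0 + (b - a)))"
    by simp
  then show ?thesis by (simp add: power2_eq_square algebra_simps)
qed

text \<open>If the premium only sees the value of the indemnity at \<open>v\<close>, then \<open>h a\<close> is the objective of the
  indemnity \<open>min y a + max (y - v) 0\<close> (see \<open>mv_objective_layer\<close> below). Its formal
  derivative in \<open>a\<close> is \<open>1 + \<theta>\<close> minus the survival function minus \<open>c\<close> times the expected layer;
  as the two pointwise subgradient inequalities integrate, this is a subgradient on \<open>{0..v}\<close>.\<close>

lemma (in prob_space) layer_cost_subgradient:
  fixes Y :: "'a \<Rightarrow> real" and v \<theta> c :: real
  assumes Y[measurable]: "Y \<in> borel_measurable M"
    and "0 \<le> c" and a: "a \<in> {0..v}" and b: "b \<in> {0..v}"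
  defines "R \<equiv> \<lambda>a \<omega>. max (min (Y \<omega>) v - a) 0"
  defines "h \<equiv> \<lambda>a. (1 + \<theta>) * a + expectation (R a) + c / 2 * expectation (\<lambda>\<omega>. (R a \<omega>)\<^sup>2)"
  shows "h a + (\<theta> + distrib_fun M Y a - c * expectation (R a)) * (b - a) \<le> h b"
proof -
  have [measurable]: "R d \<in> borel_measurable M" for d
    unfolding R_def by measurable
  have R_bound: "0 \<le> R d \<omega> \<and> R d \<omega> \<le> v" if "d \<in> {0..v}" for d \<omega>
    using that by (auto simp: R_def)
  have int[simp]: "integrable M (R d)" "integrable M (\<lambda>\<omega>. (R d \<omega>)\<^sup>2)" if "d \<in> {0..v}" for d
  proof -
    show "integrable M (R d)"
      using R_bound[OF that] by (intro integrable_const_bound[of _ v]) auto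
    show "integrable M (\<lambda>\<omega>. (R d \<omega>)\<^sup>2)"
      using R_bound[OF that] by (intro integrable_const_bound[of _ "v\<^sup>2"]) (auto intro: power_mono)
  qed
  have ind: "integrable M (\<lambda>\<omega>. indicat_real {a<..} (Y \<omega>))"
    by (rule integrable_const_bound[of _ 1]) (auto simp: indicator_def)
  have "expectation (\<lambda>\<omega>. R a \<omega> - indicat_real {a<..} (Y \<omega>) * (b - a)
      + c / 2 * ((R a \<omega>)\<^sup>2 - 2 * R a \<omega> * (b - a)))
    \<le> expectation (\<lambda>\<omega>. R b \<omega> + c / 2 * (R b \<omega>)\<^sup>2)"
  proof (rule integral_mono)
    show "R a \<omega> - indicat_real {a<..} (Y \<omega>) * (b - a)
        + c / 2 * ((R a \<omega>)\<^sup>2 - 2 * R a \<omega> * (b - a)) \<le> R b \<omega> + c / 2 * (R b \<omega>)\<^sup>2" for \<omega>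
      using a b \<open>0 \<le> c\<close> unfolding R_def
      by (intro add_mono layer_subgradient mult_left_mono layer_square_subgradient) auto
  qed (use int[OF a] int[OF b] ind in simp_all)
  moreover have "expectation (\<lambda>\<omega>. R a \<omega> - indicat_real {a<..} (Y \<omega>) * (b - a)
      + c / 2 * ((R a \<omega>)\<^sup>2 - 2 * R a \<omega> * (b - a))) =
    expectation (R a) - survival_fun M Y a * (b - a)
      + c / 2 * (expectation (\<lambda>\<omega>. (R a \<omega>)\<^sup>2) - 2 * expectation (R a) * (b - a))"
    using int[OF a] ind by (simp add: survival_fun_eq)
  moreover have "expectation (\<lambda>\<omega>. R b \<omega> + c / 2 * (R b \<omega>)\<^sup>2) =
      expectation (R b) + c / 2 * expectation (\<lambda>\<omega>. (R b \<omega>)\<^sup>2)"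
    using int[OF b] by simp
  ultimately show ?thesis
    by (simp add: h_def survival_fun_def algebra_simps)
qed

section \<open>Optimal indemnities\<close>

lemma premium_of_point_mass:
  assumes Q: "prob_space Q" and Y: "Y \<in> borel_measurable Q"
    and nonneg: "\<And>\<omega>. \<omega> \<in> space Q \<Longrightarrow> 0 \<le> Y \<omega>"
    and AE: "AE \<omega> in Q. Y \<omega> = v" and I: "I \<in> indemnities"
  shows "premium \<theta> Q Y I = (1 + \<theta>) * I v"
proof -
  interpret Q: prob_space Q by fact
  have "(LINT \<omega>|Q. I (Y \<omega>)) = (LINT \<omega>|Q. I v)"
    using borel_measurable_indemnity[OF I Y nonneg] AE by (intro integral_cong_AE) auto
  then show ?thesis by (simp add: premium_def Q.prob_space)
qed

lemma mv_objective_layer: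
  assumes prem: "\<And>I. I \<in> indemnities \<Longrightarrow> premium \<theta> Q Y I = (1 + \<theta>) * I v"
    and a: "a \<in> {0..v}"
  shows "mv_objective T r \<gamma> \<theta> P Q Y t (\<lambda>y. min y a + max (y - v) 0) =
    (1 + \<theta>) * a + (LINT \<omega>|P. max (min (Y \<omega>) v - a) 0)
    + \<gamma> * exp (r * (T - t)) / 2 * (LINT \<omega>|P. (max (min (Y \<omega>) v - a) 0)\<^sup>2)"
proof -
  have "min v a = a" using a by simp
  then show ?thesis
    using a prem[OF layer_in_indemnities, of a v]
    unfolding mv_objective_def by (simp add: retained_of_layer)
qed

text \<open>Both indemnities have the value \<open>I v\<close> at \<open>v\<close> and hence the same premium, while the layer leaves
  the pointwise smallest, nonnegative, retained risk.\<close>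

lemma mv_objective_layer_le:
  assumes P: "prob_space P" and Y: "Y \<in> borel_measurable P"
    and nonneg: "\<And>\<omega>. \<omega> \<in> space P \<Longrightarrow> 0 \<le> Y \<omega>"
    and intY: "integrable P Y" "integrable P (\<lambda>\<omega>. (Y \<omega>)\<^sup>2)"
    and "0 \<le> \<gamma>" and "0 \<le> v"
    and prem: "\<And>I. I \<in> indemnities \<Longrightarrow> premium \<theta> Q Y I = (1 + \<theta>) * I v"
    and I: "I \<in> indemnities"
  shows "mv_objective T r \<gamma> \<theta> P Q Y t (\<lambda>y. min y (I v) + max (y - v) 0)
    \<le> mv_objective T r \<gamma> \<theta> P Q Y t I"
proof -
  interpret P: prob_space P by fact
  note [measurable] = Y borel_measurable_indemnity[OF I Y nonneg]
  let ?L = "\<lambda>\<omega>. max (min (Y \<omega>) v - I v) 0"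
  have Iv: "I v \<in> {0..v}" using indemnitiesD(3,4)[OF I \<open>0 \<le> v\<close>] by simp
  have le: "?L \<omega> \<le> Y \<omega> - I (Y \<omega>)" if "\<omega> \<in> space P" for \<omega>
    using retained_layer_le[OF I nonneg[OF that] \<open>0 \<le> v\<close>] .
  have le_Y: "Y \<omega> - I (Y \<omega>) \<le> Y \<omega>" if "\<omega> \<in> space P" for \<omega>
    using indemnitiesD(3)[OF I nonneg[OF that]] by simp
  have nn: "0 \<le> Y \<omega> - I (Y \<omega>)" if "\<omega> \<in> space P" for \<omega>
    using indemnitiesD(4)[OF I nonneg[OF that]] by simp
  have sq: "(Y \<omega> - I (Y \<omega>))\<^sup>2 \<le> (Y \<omega>)\<^sup>2" "(?L \<omega>)\<^sup>2 \<le> (Y \<omega> - I (Y \<omega>))\<^sup>2"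
    if "\<omega> \<in> space P" for \<omega>
    using le[OF that] le_Y[OF that] nn[OF that] by (auto intro!: power_mono)
  have int: "integrable P (\<lambda>\<omega>. Y \<omega> - I (Y \<omega>))"
    using le_Y nn nonneg
    by (intro Bochner_Integration.integrable_bound[OF intY(1)]) auto
  have int2: "integrable P (\<lambda>\<omega>. (Y \<omega> - I (Y \<omega>))\<^sup>2)"
    using sq by (intro Bochner_Integration.integrable_bound[OF intY(2)]) auto
  have intL: "integrable P ?L"
    using le nn by (intro Bochner_Integration.integrable_bound[OF int]) auto
  have intL2: "integrable P (\<lambda>\<omega>. (?L \<omega>)\<^sup>2)"
    using sq by (intro Bochner_Integration.integrable_bound[OF int2]) auto
  have "mv_objective T r \<gamma> \<theta> P Q Y t (\<lambda>y. min y (I v) + max (y - v) 0) =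
    (1 + \<theta>) * I v + (LINT \<omega>|P. ?L \<omega>)
    + \<gamma> * exp (r * (T - t)) / 2 * (LINT \<omega>|P. (?L \<omega>)\<^sup>2)"
    by (rule mv_objective_layer[OF prem Iv])
  also have "\<dots> \<le> mv_objective T r \<gamma> \<theta> P Q Y t I"
    unfolding mv_objective_def prem[OF I]
    using le sq int int2 intL intL2 \<open>0 \<le> \<gamma>\<close>
    by (intro add_mono order_refl mult_left_mono integral_mono) auto
  finally show ?thesis .
qed

theorem proposition4:
  fixes P Q :: "'a measure" and Y :: "'a \<Rightarrow> real" and f :: "real \<Rightarrow> ennreal"
    and T r \<gamma> \<theta> \<alpha> :: real
  assumes "T > 0" and "r > 0" and "\<gamma> > 0" and "\<theta> \<ge> 0"
    and "0 < \<alpha>" and "\<alpha> < 1"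
    and "prob_space P" and "prob_space Q" and "sets Q = sets P"
    and "Y \<in> borel_measurable P" and "\<forall>\<omega>\<in>space P. Y \<omega> > 0"
    and "integrable P Y" and "integrable P (\<lambda>\<omega>. (Y \<omega>)\<^sup>2)"
    and "integrable Q Y" and "integrable Q (\<lambda>\<omega>. (Y \<omega>)\<^sup>2)"
    and "distributed P lborel Y f"
    and "\<forall>y. distrib_fun Q Y y = 1 - VaR_distortion \<alpha> (survival_fun P Y y)"
  shows "(\<forall>I\<in>indemnities. premium \<theta> Q Y I = (1 + \<theta>) * VaR \<alpha> P (\<lambda>\<omega>. I (Y \<omega>))) \<and>
    optimal_indemnity T r \<gamma> \<theta> P Q Y
      (\<lambda>t y. min y (VaR_retention T r \<gamma> \<theta> \<alpha> P Y t) + max (y - VaR \<alpha> P Y) 0)"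
proof -
  interpret P: prob_space P by fact
  note P = \<open>prob_space P\<close> and Q = \<open>prob_space Q\<close> and YP = \<open>Y \<in> borel_measurable P\<close>
    and \<alpha> = \<open>0 < \<alpha>\<close> \<open>\<alpha> < 1\<close>
  have YQ: "Y \<in> borel_measurable Q"
    using \<open>integrable Q Y\<close> by (rule borel_measurable_integrable)
  have nonneg: "0 \<le> Y \<omega>" if "\<omega> \<in> space P" for \<omega>
    using that assms(11) by (simp add: less_imp_le)
  have nonnegQ: "0 \<le> Y \<omega>" if "\<omega> \<in> space Q" for \<omega>
    using that nonneg sets_eq_imp_space_eq[OF \<open>sets Q = sets P\<close>] by simp
  define v where "v = VaR \<alpha> P Y"
  have "0 \<le> v"
    unfolding v_def by (rule VaR_nonneg[OF P YP nonneg \<alpha>])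
  have Fv: "distrib_fun P Y v = 1 - \<alpha>"
    unfolding v_def by (rule distrib_fun_VaR_of_density[OF P assms(16) nonneg \<alpha>])
  have "AE \<omega> in Q. Y \<omega> = v"
    unfolding v_def using AE_eq_VaR_of_distorted_law[OF P YP nonneg \<alpha> Q YQ] assms(17) by blast
  then have prem: "premium \<theta> Q Y I = (1 + \<theta>) * I v" if "I \<in> indemnities" for I
    using premium_of_point_mass[OF Q YQ nonnegQ _ that] by blast
  have "optimal_indemnity T r \<gamma> \<theta> P Q Y
      (\<lambda>t y. min y (VaR_retention T r \<gamma> \<theta> \<alpha> P Y t) + max (y - v) 0)"
    unfolding optimal_indemnity_def
  proof (intro ballI)
    fix t
    define c where "c = \<gamma> * exp (r * (T - t))"
    have "0 \<le> c" using \<open>\<gamma> > 0\<close> by (simp add: c_def)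
    let ?a = "VaR_retention T r \<gamma> \<theta> \<alpha> P Y t"
    define \<phi> where "\<phi> = (\<lambda>a. \<theta> + distrib_fun P Y a
      + c * (a * survival_fun P Y a - \<alpha> * v - (LINT y:{a<..v}|distr P borel Y. y)))"
    define h where "h = (\<lambda>a. (1 + \<theta>) * a + (LINT \<omega>|P. max (min (Y \<omega>) v - a) 0)
      + c / 2 * (LINT \<omega>|P. (max (min (Y \<omega>) v - a) 0)\<^sup>2))"
    have h: "mv_objective T r \<gamma> \<theta> P Q Y t (\<lambda>y. min y a + max (y - v) 0) = h a"
      if "a \<in> {0..v}" for a
      unfolding h_def c_def by (rule mv_objective_layer[OF prem that])
    have \<phi>: "\<phi> a = \<theta> + distrib_fun P Y a - c * (LINT \<omega>|P. max (min (Y \<omega>) v - a) 0)"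
      if "a \<in> {0..v}" for a
    proof -
      have "a * survival_fun P Y a - \<alpha> * v - (LINT y:{a<..v}|distr P borel Y. y) =
          - (LINT \<omega>|P. max (min (Y \<omega>) v - a) 0)"
        using that P.expectation_layer[OF YP, of a v] Fv
        by (simp add: survival_fun_def algebra_simps)
      then show ?thesis by (simp add: \<phi>_def)
    qed
    have subgradient: "h a + \<phi> a * (b - a) \<le> h b" if "a \<in> {0..v}" "b \<in> {0..v}" for a b
      unfolding h_def \<phi>[OF that(1)]
      by (rule P.layer_cost_subgradient[OF YP \<open>0 \<le> c\<close> that])
    have \<phi>v: "0 \<le> \<phi> v"
      using \<open>\<theta> \<ge> 0\<close> \<alpha> Fv by (simp add: \<phi>_def survival_fun_def set_lebesgue_integral_def)
    have a_eq: "?a = Inf {a \<in> {0..v}. 0 \<le> \<phi> a}"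
      by (simp add: VaR_retention_def \<phi>_def c_def v_def)
    have a: "?a \<in> {0..v}"
      unfolding a_eq by (rule Inf_nonneg_subgradient_minimises(1)[OF subgradient \<open>0 \<le> v\<close> \<phi>v])
    have "mv_objective T r \<gamma> \<theta> P Q Y t (\<lambda>y. min y ?a + max (y - v) 0)
        \<le> mv_objective T r \<gamma> \<theta> P Q Y t I" if I: "I \<in> indemnities" for I
    proof -
      have Iv: "I v \<in> {0..v}"
        using indemnitiesD(3,4)[OF I \<open>0 \<le> v\<close>] by simp
      have "h ?a \<le> h (I v)"
        unfolding a_eq by (rule Inf_nonneg_subgradient_minimises(2)[OF subgradient \<open>0 \<le> v\<close> \<phi>v Iv])
      also have "h (I v) \<le> mv_objective T r \<gamma> \<theta> P Q Y t I"
        unfolding h[OF Iv, symmetric] using \<open>\<gamma> > 0\<close> I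
        by (intro mv_objective_layer_le[OF P YP nonneg assms(12,13) _ \<open>0 \<le> v\<close> prem]) auto
      finally show ?thesis by (simp add: h[OF a])
    qed
    then show "(\<lambda>y. min y ?a + max (y - v) 0) \<in> indemnities \<and>
        (\<forall>I\<in>indemnities. mv_objective T r \<gamma> \<theta> P Q Y t (\<lambda>y. min y ?a + max (y - v) 0)
          \<le> mv_objective T r \<gamma> \<theta> P Q Y t I)"
      using a layer_in_indemnities[of ?a v] by simp
  qed
  moreover have "premium \<theta> Q Y I = (1 + \<theta>) * VaR \<alpha> P (\<lambda>\<omega>. I (Y \<omega>))" if "I \<in> indemnities" for I
    using prem[OF that] VaR_indemnity[OF P YP nonneg \<alpha> that] by (simp add: v_def)
  ultimately show ?thesis by (simp add: v_def)
qed

end
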